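(* Let $\mathbf{N}=\{1,2,3,\dots\}$. (i) There is a colouring of $\mathbf{N}$ with $3$ colours for which the only monochromatic solution of $x+y=z^2$ (that is, the only triple $(x,y,z)\in\mathbf{N}^3$ with $x+y=z^2$ and $x,y,z$ all of the same colour) is the trivial solution $x=y=z=2$. (ii) For every colouring of $\mathbf{N}$ with $2$ colours there are infinitely many triples $(x,y,z)\in\mathbf{N}^3$ with $x+y=z^2$ and $x,y,z$ all of the same colour.
   Context: A $k$-colouring of $\mathbf{N}$ is a map from $\mathbf{N}$ to a set of $k$ colours. The elements $x,y,z$ in a solution are not required to be distinct. *)

theory Defs
  imports "HOL-Library.FuncSet"
begin

text \<open>The naturals of the statement start at 1, so a colouring is a map on \<open>nat\<close> of which only the
  values on \<open>{1..}\<close> matter; the value at 0 is unconstrained. Not every colour need be used.\<close>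

definition colouring :: "nat \<Rightarrow> 'c set \<Rightarrow> (nat \<Rightarrow> 'c) \<Rightarrow> bool" where
  "colouring k C f \<longleftrightarrow> finite C \<and> card C = k \<and> f \<in> {1..} \<rightarrow> C"

definition mono_solutions :: "(nat \<Rightarrow> 'c) \<Rightarrow> (nat \<times> nat \<times> nat) set" where
  "mono_solutions f =
    {(x, y, z). x \<ge> 1 \<and> y \<ge> 1 \<and> z \<ge> 1 \<and> x + y = z ^ 2 \<and> f x = f y \<and> f y = f z}"

end

theory Submission
  imports Defs
begin

text \<open>In a solution of \<open>x + y = z\<^sup>2\<close> the larger summand lies between \<open>z\<^sup>2 / 2\<close> and \<open>z\<^sup>2\<close>. For three
  colours, cut the numbers from 3 on into blocks, each of which ends at about half the square of its
  start. If \<open>z\<close> is in block \<open>j\<close>, the larger summand is then in block \<open>j + 1\<close> or \<open>j + 2\<close>, so colouring a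
  block by its index modulo 3 leaves only the small case \<open>z = 2\<close>, which is settled by hand.

  For two colours, suppose that no solution with \<open>z \<ge> N\<close> is monochromatic (\<open>avoiding\<close>); finitely many
  monochromatic solutions would give such an \<open>N\<close>. Call the colours blue (\<open>c\<close> holds) and red. If \<open>z\<close> is
  blue and \<open>z + 1\<close> is red, a switch at \<open>z\<close>, then a blue \<open>x < z\<^sup>2\<close> forces \<open>z\<^sup>2 - x\<close> to be red, which
  forces \<open>(z + 1)\<^sup>2 - (z\<^sup>2 - x) = x + 2z + 1\<close> to be blue (\<open>switch_translates\<close>). Everything
  else comes from this translation rule and its mirror image under exchange of the colours.

  First, the rule bounds the length of a monochromatic run (\<open>run_length_bound\<close>), so that the switches
  \<open>z\<^sub>1 < w < z\<^sub>2\<close> at the ends of three successive runs have bounded ratios. Second, the translations of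
  three switches combine: blue is closed under subtracting \<open>2(w - z\<^sub>1)\<close> and under adding
  \<open>2(z\<^sub>2 - w)\<close>. By finiteness, closure under both steps implies closure under their inverses
  (\<open>closed_under_two_shifts\<close>), so \<open>c\<close> has period \<open>p = 2(w - z\<^sub>1)\<close> below \<open>z\<^sub>1\<^sup>2\<close>
  (\<open>three_switches_period\<close>). Third, this period repeats the switches at \<open>z\<^sub>1 + N p\<close>, \<open>w + N p\<close> and
  \<open>z\<^sub>1 + (N + 1) p\<close>. The second step, applied to these, gives the same period \<open>p\<close> beyond
  \<open>(N p)\<^sup>2\<close>. All multiples of \<open>p\<close> in that range have one colour, and \<open>x = p\<close>, \<open>z = N p\<close> is part
  of a monochromatic solution (\<open>no_close_switches\<close>).\<close>

section \<open>A colouring with three colours by doubly exponential blocks\<close>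

text \<open>The next start is half the square of the current one, rounded up: the least possible larger
  summand when \<open>z\<close> is the first element of the current block.\<close>

fun block_start :: "nat \<Rightarrow> nat" where
  "block_start 0 = 3"
| "block_start (Suc j) = ((block_start j)\<^sup>2 + 1) div 2"

lemma block_start_ge: "block_start j \<ge> j + 3"
proof (induction j)
  case (Suc j)
  have "3 * block_start j \<le> (block_start j)\<^sup>2"
    using Suc by (simp add: power2_eq_square)
  then show ?case using Suc by simp
qed simp

lemma block_start_less_Suc: "block_start j < block_start (Suc j)"
proof -
  have "3 * block_start j \<le> (block_start j)\<^sup>2"
    using block_start_ge[of j] by (simp add: power2_eq_square)
  then show ?thesis using block_start_ge[of j] by simp
qed

lemma block_start_mono: "i \<le> j \<Longrightarrow> block_start i \<le> block_start j"
  by (rule lift_Suc_mono_le[of block_start, OF less_imp_le[OF block_start_less_Suc]])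

text \<open>Squaring moves up by one block and a factor of 2; the factor is absorbed by one more block, since
  halving a square at least doubles a number that is at least 4.\<close>

lemma square_less_block_start: "n < block_start (Suc j) \<Longrightarrow> n\<^sup>2 < block_start (Suc (j + 2))"
proof -
  define u v where "u = block_start (Suc j)" and "v = block_start (Suc (Suc j))"
  assume "n < block_start (Suc j)"
  then have "n\<^sup>2 < u\<^sup>2" by (simp add: u_def power_strict_mono)
  also have "u\<^sup>2 \<le> 2 * v" by (simp add: u_def v_def)
  also have "2 * v \<le> (v\<^sup>2 + 1) div 2"
  proof -
    have "4 * v \<le> v\<^sup>2"
      using block_start_ge[of "Suc (Suc j)"] by (simp add: v_def power2_eq_square)
    then show ?thesis by simp
  qed
  finally show ?thesis by (simp add: v_def)
qed

text \<open>The numbers below the first start, 3, get index 0 as well.\<close>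

definition block :: "nat \<Rightarrow> nat" where
  "block n = (LEAST j. n < block_start (Suc j))"

lemma less_block_start_Suc_block: "n < block_start (Suc (block n))"
  unfolding block_def
proof (rule LeastI[of "\<lambda>j. n < block_start (Suc j)"])
  show "n < block_start (Suc n)" using block_start_ge[of "Suc n"] by simp
qed

lemma block_le_iff: "block n \<le> j \<longleftrightarrow> n < block_start (Suc j)"
proof
  assume "block n \<le> j"
  then show "n < block_start (Suc j)"
    using less_block_start_Suc_block[of n] block_start_mono[of "Suc (block n)" "Suc j"] by simp
next
  assume "n < block_start (Suc j)"
  then show "block n \<le> j" unfolding block_def by (rule Least_le[of "\<lambda>j. n < block_start (Suc j)"])
qed

lemma block_start_block_le:
  assumes "n \<ge> 3" shows "block_start (block n) \<le> n"
proof (cases "block n")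
  case 0
  show ?thesis unfolding 0 using assms by simp
next
  case (Suc i)
  then have "\<not> block n \<le> i" by linarith
  then have "block_start (Suc i) \<le> n" by (simp only: block_le_iff not_less)
  then show ?thesis unfolding Suc .
qed

lemma block_of_large_summand:
  assumes "z \<ge> 3" and "x + y = z\<^sup>2" and "x \<le> y" and "x \<ge> 1"
  shows "block y = block z + 1 \<or> block y = block z + 2"
proof -
  have "(block_start (block z))\<^sup>2 \<le> z\<^sup>2"
    using block_start_block_le[OF assms(1)] by (simp add: power_mono)
  then have "(block_start (block z))\<^sup>2 \<le> 2 * y" using assms by linarith
  then have "block_start (Suc (block z)) \<le> y" by simp
  then have "\<not> block y \<le> block z" by (simp only: block_le_iff not_less)
  moreover have "y < block_start (Suc (block z + 2))"
    by (rule le_less_trans[OF _ square_less_block_start[OF less_block_start_Suc_block[of z]]])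
      (use assms(2) in simp)
  then have "block y \<le> block z + 2" by (rule block_le_iff[THEN iffD2])
  ultimately show ?thesis by linarith
qed

text \<open>The numbers 1 and 2 must not share the colour of 3, because of \<open>1 + 3 = 2\<^sup>2\<close>; colour 1 serves,
  as 3 lies in block 0.\<close>

definition block_colour :: "nat \<Rightarrow> nat" where
  "block_colour n = (if n < 3 then 1 else block n mod 3)"

lemma block_colour_large_summand:
  assumes "z \<ge> 3" and "x + y = z\<^sup>2" and "x \<le> y" and "x \<ge> 1"
  shows "block_colour y \<noteq> block_colour z"
proof -
  have "3 * 3 \<le> z * z" using assms(1) by (intro mult_mono) auto
  then have "y \<ge> 3" using assms by (simp add: power2_eq_square)
  moreover have "(j + 1) mod 3 \<noteq> j mod 3" "(j + 2) mod 3 \<noteq> j mod 3" for j :: nat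
    by presburger+
  then have "block y mod 3 \<noteq> block z mod 3"
    using block_of_large_summand[OF assms] by metis
  ultimately show ?thesis using assms(1) by (simp add: block_colour_def)
qed

lemma block_colour_3: "block_colour 3 = 0"
proof -
  have "block 3 \<le> 0" unfolding block_le_iff by (simp add: power2_eq_square)
  then show ?thesis by (simp add: block_colour_def)
qed

lemma mono_solutions_block_colour: "mono_solutions block_colour = {(2, 2, 2)}"
proof
  show "{(2, 2, 2)} \<subseteq> mono_solutions block_colour" by (simp add: mono_solutions_def)
next
  show "mono_solutions block_colour \<subseteq> {(2, 2, 2)}"
  proof
    fix s assume "s \<in> mono_solutions block_colour"
    then obtain x y z where s: "s = (x, y, z)" and pos: "x \<ge> 1" "y \<ge> 1" "z \<ge> 1"
      and eq: "x + y = z\<^sup>2" and col: "block_colour x = block_colour y" "block_colour y = block_colour z"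
      by (cases s) (auto simp: mono_solutions_def)
    have "z < 3"
    proof (rule ccontr)
      assume "\<not> z < 3"
      then show False
        using block_colour_large_summand[of z x y] block_colour_large_summand[of z y x] pos eq col
        by (metis add.commute le_cases not_less)
    qed
    moreover have "z \<noteq> 1" using pos eq by auto
    ultimately have z: "z = 2" using pos by linarith
    then have sum: "x + y = 4" using eq by simp
    have "block_colour z = 1" using z by (simp add: block_colour_def)
    then have "x \<noteq> 3" "y \<noteq> 3" using block_colour_3 col by auto
    then show "s \<in> {(2, 2, 2)}" using s z sum pos by auto
  qed
qed

lemma colouring_block_colour: "colouring 3 {0, 1, 2} block_colour"
  by (auto simp: colouring_def block_colour_def)

section \<open>Colour switches as translations\<close>

text \<open>Only \<open>z\<close> is bounded below, since \<open>z\<close> determines finitely many pairs \<open>x\<close>, \<open>y\<close>.\<close>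

definition avoiding :: "nat \<Rightarrow> (nat \<Rightarrow> bool) \<Rightarrow> bool" where
  "avoiding N c \<longleftrightarrow>
    (\<forall>x y z. 1 \<le> x \<longrightarrow> 1 \<le> y \<longrightarrow> N \<le> z \<longrightarrow> x + y = z\<^sup>2 \<longrightarrow> \<not> (c x = c y \<and> c y = c z))"

lemma avoidingD:
  "avoiding N c \<Longrightarrow> 1 \<le> x \<Longrightarrow> 1 \<le> y \<Longrightarrow> N \<le> z \<Longrightarrow> x + y = z\<^sup>2 \<Longrightarrow> c x = c y \<Longrightarrow> c y = c z \<Longrightarrow> False"
  unfolding avoiding_def by blast

lemma avoiding_swap: "avoiding N c \<Longrightarrow> avoiding N (\<lambda>n. \<not> c n)"
  by (simp add: avoiding_def)

text \<open>The number \<open>z\<^sup>2 - x\<close> completes \<open>x\<close> to \<open>z\<^sup>2\<close> and completes \<open>x + 2z + 1\<close> to \<open>(z + 1)\<^sup>2\<close>. The first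
  makes it differ from \<open>c z\<close>; then it agrees with \<open>c (z + 1)\<close>, so the second completion cannot.\<close>

lemma switch_translates:
  assumes "avoiding N c" and "N \<le> z" and "c z" and "\<not> c (z + 1)"
    and "1 \<le> x" and "x < z\<^sup>2" and "c x"
  shows "c (x + 2 * z + 1)"
proof (rule ccontr)
  assume no: "\<not> c (x + 2 * z + 1)"
  have pos: "1 \<le> z\<^sup>2 - x" using assms(6) by linarith
  then have "\<not> c (z\<^sup>2 - x)"
    using avoidingD[OF assms(1) assms(5) pos assms(2)] assms by auto
  moreover have "(x + 2 * z + 1) + (z\<^sup>2 - x) = (z + 1)\<^sup>2"
    using assms(6) by (simp add: power2_eq_square)
  ultimately show False
    using avoidingD[OF assms(1), of "x + 2 * z + 1" "z\<^sup>2 - x" "z + 1"] no pos assms by simp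
qed

lemma switch_translates_iter:
  assumes "avoiding N c" and "N \<le> z" and "c z" and "\<not> c (z + 1)"
    and "1 \<le> x" and "c x" and "x + k * (2 * z + 1) \<le> z\<^sup>2"
  shows "c (x + k * (2 * z + 1))"
  using assms(7)
proof (induction k)
  case (Suc k)
  then show ?case
    using switch_translates[OF assms(1-4), of "x + k * (2 * z + 1)"] assms(5) by (simp add: algebra_simps)
qed (use assms in simp)

text \<open>If \<open>b\<^sup>2\<close> is congruent to \<open>x + y\<close> modulo \<open>2b + 1\<close> with \<open>x\<close> and \<open>y\<close> in the run, then the
  translation by \<open>2b + 1\<close> at the end of the run, repeated, carries \<open>x\<close> to \<open>b\<^sup>2 - y\<close>, which gives a
  monochromatic solution. The sums \<open>x + y\<close> fill \<open>{2a + 2..2b}\<close>, and the residue of \<open>b\<^sup>2\<close>, an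
  inverse of 4 modulo \<open>2b + 1\<close>, falls into that interval as soon as \<open>b > 4a + 2\<close>.\<close>

lemma run_length_bound:
  assumes av: "avoiding N c" and "N \<le> b" and run: "\<And>n. a < n \<Longrightarrow> n \<le> b \<Longrightarrow> c n"
    and "\<not> c (b + 1)"
  shows "b \<le> 4 * a + 2"
proof (rule ccontr)
  assume "\<not> b \<le> 4 * a + 2"
  then have b: "b \<ge> 4 * a + 3" by simp
  obtain r k where rk: "b\<^sup>2 = r + k * (2 * b + 1)" and r: "2 * a + 2 \<le> r" "r \<le> 2 * b"
    \<comment> \<open>The residue is \<open>3b / 2 + 1\<close> for even \<open>b\<close> and \<open>(b + 1) / 2\<close> for odd \<open>b\<close>; the odd case
      decides the constant 4.\<close>
  proof (cases "even b")
    case True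
    then obtain t where t: "b = 2 * t" by blast
    then obtain u where u: "t = Suc u" using b by (cases t) auto
    show ?thesis
      by (rule that[of "3 * t + 1" u]) (use b t u in \<open>auto simp: power2_eq_square algebra_simps\<close>)
  next
    case False
    then obtain t where t: "b = 2 * t + 1" using oddE by blast
    show ?thesis
      by (rule that[of "t + 1" t]) (use b t in \<open>auto simp: power2_eq_square algebra_simps\<close>)
  qed
  obtain x y where xy: "x + y = r" "a < x" "x \<le> b" "a < y" "y \<le> b"
  proof (cases "r \<le> a + 1 + b")
    case True
    show ?thesis by (rule that[of "a + 1" "r - (a + 1)"]) (use True r b in auto)
  next
    case False
    show ?thesis by (rule that[of b "r - b"]) (use False r b in auto)
  qed
  have cb: "c b" using run b by simp
  have "c (x + k * (2 * b + 1))"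
    using switch_translates_iter[OF av assms(2) cb assms(4), of x k] run[of x] xy rk by simp
  then show False
    using avoidingD[OF av, of "x + k * (2 * b + 1)" y b] run[of y] cb xy rk assms(2) by simp
qed

section \<open>Periodicity from three switches\<close>

text \<open>On a window of length \<open>a + b\<close>, stepping down by \<open>a\<close> where possible and up by \<open>b\<close> otherwise is a
  rotation. It maps the true points of the window into themselves, hence, being injective on a finite
  set, onto themselves; so its inverse also preserves them, and the inverse of a step down is a step
  up by \<open>a\<close>.\<close>

lemma closed_under_two_shifts:
  fixes c :: "nat \<Rightarrow> bool"
  assumes down: "\<And>x. a < x \<Longrightarrow> x \<le> L \<Longrightarrow> c x \<Longrightarrow> c (x - a)"
    and up: "\<And>x. 1 \<le> x \<Longrightarrow> x + b \<le> L \<Longrightarrow> c x \<Longrightarrow> c (x + b)"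
    and "1 \<le> b" and L: "a + b \<le> L" and x: "1 \<le> x" "x + a \<le> L"
  shows "c (x + a) = c x"
proof
  assume "c (x + a)"
  then show "c x" using down[of "x + a"] x by simp
next
  assume "c x"
  \<comment> \<open>The window is \<open>{t + 1..t + a + b}\<close>. It has to contain \<open>x\<close> and \<open>x + a\<close> and stay below \<open>L\<close>, so it
    starts at \<open>x\<close> unless that is too close to \<open>L\<close>.\<close>
  define t where "t = min (x - 1) (L - (a + b))"
  have t: "t + 1 \<le> x" "x \<le> t + b" "t + a + b \<le> L"
    using assms(3) L x by (auto simp: t_def min_def)
  define T where "T y = (if t + a < y then y - a else y + b)" for y
  define W where "W = {y \<in> {t + 1..t + a + b}. c y}"
  have "T ` W \<subseteq> W"
    using t(3) down up by (auto simp: T_def W_def)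
  moreover have inj: "inj_on T {t + 1..t + a + b}"
  proof (rule inj_onI)
    fix y y' assume "y \<in> {t + 1..t + a + b}" "y' \<in> {t + 1..t + a + b}" "T y = T y'"
    then show "y = y'" unfolding T_def by (cases "t + a < y"; cases "t + a < y'") simp_all
  qed
  then have "inj_on T W" by (rule inj_on_subset) (auto simp: W_def)
  moreover have "finite W" by (simp add: W_def)
  ultimately have "T ` W = W" by (simp add: endo_inj_surj)
  moreover have "x \<in> W" using t \<open>c x\<close> by (simp add: W_def)
  ultimately obtain y where y: "y \<in> W" "T y = x" by (metis imageE)
  have "T (x + a) = x" using t by (simp add: T_def)
  then have "T y = T (x + a)" by (simp only: y(2))
  moreover have "y \<in> {t + 1..t + a + b}" "x + a \<in> {t + 1..t + a + b}"
    using y(1) t by (simp_all add: W_def)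
  ultimately have "y = x + a" by (rule inj_onD[OF inj])
  then show "c (x + a)" using y by (simp add: W_def)
qed

text \<open>The switches at \<open>z1\<close> and \<open>z2\<close> move blue up by \<open>2 z1 + 1\<close> and \<open>2 z2 + 1\<close>; the opposite switch at
  \<open>w\<close> moves red up, hence blue down, by \<open>2w + 1\<close>. The two differences are the shifts of
  \<open>closed_under_two_shifts\<close>. Its window of length \<open>2(z2 - z1)\<close> has to fit below \<open>z1\<^sup>2\<close>, where all
  three translations are valid.\<close>

lemma three_switches_period:
  assumes av: "avoiding N c" and "N \<le> z1" and "z1 < w" and "w < z2"
    and z1: "c z1" "\<not> c (z1 + 1)" and w: "\<not> c w" "c (w + 1)" and z2: "c z2" "\<not> c (z2 + 1)"
    and small: "2 * (z2 - z1) < z1\<^sup>2" and x: "1 \<le> x" "x + 2 * (w - z1) < z1\<^sup>2"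
  shows "c (x + 2 * (w - z1)) = c x"
proof -
  have sq: "z1\<^sup>2 < w\<^sup>2" "w\<^sup>2 < z2\<^sup>2" using assms(3,4) by (auto simp: power_strict_mono)
  \<comment> \<open>The translation rule for red at \<open>w\<close>, in contrapositive form.\<close>
  have pull_down: "c u" if "1 \<le> u" "u < w\<^sup>2" "c (u + 2 * w + 1)" for u
    using switch_translates[OF avoiding_swap[OF av], of w u] that w assms(2,3) by auto
  show ?thesis
  proof (rule closed_under_two_shifts[where L = "z1\<^sup>2 - 1" and b = "2 * (z2 - w)"])
    fix u assume u: "2 * (w - z1) < u" "u \<le> z1\<^sup>2 - 1" "c u"
    then have "u < z1\<^sup>2" by linarith
    then have "c (u + 2 * z1 + 1)"
      using switch_translates[OF av assms(2) z1, of u] u by simp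
    moreover have "u + 2 * z1 + 1 = u - 2 * (w - z1) + 2 * w + 1" using u assms(3) by simp
    ultimately have shifted: "c (u - 2 * (w - z1) + 2 * w + 1)" by (simp only:)
    show "c (u - 2 * (w - z1))"
      by (rule pull_down[OF _ _ shifted]) (use \<open>u < z1\<^sup>2\<close> u(1) sq in linarith)+
  next
    fix u assume u: "1 \<le> u" "u + 2 * (z2 - w) \<le> z1\<^sup>2 - 1" "c u"
    then have lt: "u + 2 * (z2 - w) < z1\<^sup>2" by linarith
    then have "c (u + 2 * z2 + 1)"
      using switch_translates[OF av _ z2, of u] u sq assms(2-4) by simp
    moreover have "u + 2 * z2 + 1 = u + 2 * (z2 - w) + 2 * w + 1" using assms(4) by simp
    ultimately have shifted: "c (u + 2 * (z2 - w) + 2 * w + 1)" by (simp only:)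
    show "c (u + 2 * (z2 - w))"
      by (rule pull_down[OF _ _ shifted]) (use lt u(1) sq in linarith)+
  qed (use assms in auto)
qed

lemma periodic_multiple:
  fixes c :: "nat \<Rightarrow> bool"
  assumes "\<And>x. 1 \<le> x \<Longrightarrow> x + p < L \<Longrightarrow> c (x + p) = c x" and "1 \<le> x" and "x + k * p < L"
  shows "c (x + k * p) = c x"
  using assms(3)
proof (induction k)
  case (Suc k)
  then show ?case using assms(1)[of "x + k * p"] assms(2) by (simp add: algebra_simps)
qed simp

text \<open>The period \<open>p\<close> may exceed \<open>z1\<close>, and then no solution in multiples of \<open>p\<close> need fit below
  \<open>z1\<^sup>2\<close>. Periodicity itself repairs this: the repeated switches \<open>z1 + N p\<close> and \<open>w + N p\<close> are as far
  apart as \<open>z1\<close> and \<open>w\<close>, so they give the same period up to \<open>(z1 + N p)\<^sup>2\<close>, and this bound exceeds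
  \<open>(N p)\<^sup>2\<close>.\<close>

lemma no_close_switches:
  assumes av: "avoiding N c" and "1 \<le> N" and "z1 < w" and "w < z2"
    and z1: "c z1" "\<not> c (z1 + 1)" and w: "\<not> c w" "c (w + 1)" and z2: "c z2" "\<not> c (z2 + 1)"
    and close: "z2 \<le> 17 * z1" and large: "40 * (N + 2) \<le> z1"
  shows False
proof -
  define p where "p = 2 * (w - z1)"
  have p: "2 \<le> p" "p \<le> 32 * z1" using assms(3,4) close by (auto simp: p_def)
  have z1_ge: "80 \<le> z1" using large by simp
  have "40 * (N + 2) * z1 \<le> z1\<^sup>2" using large by (simp add: power2_eq_square)
  then have big: "40 * (N * z1) + 80 * z1 \<le> z1\<^sup>2" by (simp add: algebra_simps)
  then have big': "80 * z1 \<le> z1\<^sup>2" by (rule add_leD2)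
  have "N * p \<le> N * (32 * z1)" using p(2) by (rule mult_le_mono2)
  then have Np: "N * p \<le> 32 * (N * z1)" by (simp only: mult.left_commute)
  have per: "c (x + p) = c x" if "1 \<le> x" "x + p < z1\<^sup>2" for x
    unfolding p_def
  proof (rule three_switches_period[OF av _ assms(3,4) z1 w z2])
    have "2 * (z2 - z1) \<le> 34 * z1" using close by simp
    then show "2 * (z2 - z1) < z1\<^sup>2" using big' z1_ge by linarith
  qed (use that large in \<open>auto simp: p_def\<close>)
  note rep = periodic_multiple[of p "z1\<^sup>2" c, OF per]
  have fit: "z1 + (N + 1) * p + 1 < z1\<^sup>2"
    using Np p big big' z1_ge by (simp only: distrib_right)
  have fitw: "w + N * p + 1 < z1\<^sup>2"
    using fit assms(3) by (simp only: distrib_right p_def)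
  \<comment> \<open>The third switch is a copy of \<open>z1\<close>, not of \<open>z2\<close>: one period further up it is certainly
    above \<open>w'\<close>, as \<open>w - z1 < p\<close>.\<close>
  define z1' w' z2' where "z1' = z1 + N * p" and "w' = w + N * p" and "z2' = z1 + (N + 1) * p"
  have sw: "c z1'" "\<not> c (z1' + 1)" "\<not> c w'" "c (w' + 1)" "c z2'" "\<not> c (z2' + 1)"
    using rep[of z1 N] rep[of "z1 + 1" N] rep[of w N] rep[of "w + 1" N]
      rep[of z1 "N + 1"] rep[of "z1 + 1" "N + 1"] fit fitw z1 w large assms(3)
    by (simp_all add: z1'_def w'_def z2'_def algebra_simps)
  have diff: "w' - z1' = w - z1" by (simp add: w'_def z1'_def)
  have "2 * p < z1\<^sup>2" using p big' z1_ge by linarith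
  also have "z1\<^sup>2 \<le> z1'\<^sup>2" by (simp add: z1'_def power_mono)
  finally have small: "2 * (z2' - z1') < z1'\<^sup>2" by (simp add: z1'_def z2'_def)
  have per': "c (x + p) = c x" if "1 \<le> x" "x + p < z1'\<^sup>2" for x
    using three_switches_period[OF av _ _ _ sw small that(1)] that large assms(3) p
    by (simp add: diff flip: p_def) (simp add: z1'_def w'_def z2'_def p_def)
  have mult: "c (k * p) = c p" if "1 \<le> k" "k * p < z1'\<^sup>2" for k
    using periodic_multiple[of p "z1'\<^sup>2" c, OF per', of p "k - 1"] that p
    by (cases k) auto
  have sq: "(N * p)\<^sup>2 < z1'\<^sup>2" by (rule power_strict_mono) (use large in \<open>auto simp: z1'_def\<close>)
  have prod: "(N * p)\<^sup>2 = N * N * p * p" by (simp add: power2_eq_square)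
  have "1 * 1 \<le> N * N" using assms(2) by (intro mult_le_mono)
  then have NNp: "2 \<le> N * N * p" using p mult_le_mono[of 1 "N * N" 2 p] by simp
  have "c (N * p) = c p"
  proof (rule mult)
    have "N * p \<le> (N * p)\<^sup>2" using assms(2) p by (intro self_le_power) auto
    then show "N * p < z1'\<^sup>2" using sq by (rule le_less_trans)
  qed (use assms(2) in simp)
  moreover have "c ((N * N * p - 1) * p) = c p"
  proof (rule mult)
    have "(N * N * p - 1) * p \<le> (N * p)\<^sup>2" by (simp add: prod)
    then show "(N * N * p - 1) * p < z1'\<^sup>2" using sq by (rule le_less_trans)
  qed (use NNp in simp)
  moreover have "p + (N * N * p - 1) * p = (N * p)\<^sup>2"
    using NNp assms(2) unfolding prod mult_eq_if[of "N * N * p" p] by simp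
  moreover have "1 \<le> N * N * p - 1" using NNp by linarith
  then have "1 * 1 \<le> (N * N * p - 1) * p" using p by (intro mult_le_mono) auto
  ultimately show False
    using avoidingD[OF av, of p "(N * N * p - 1) * p" "N * p"] p by simp
qed

section \<open>Switches with bounded ratios\<close>

text \<open>If the colour of \<open>c\<close> stopped, every large \<open>z\<close> would give the monochromatic solution
  \<open>z + (z\<^sup>2 - z) = z\<^sup>2\<close>.\<close>

lemma avoiding_recurs:
  assumes av: "avoiding N c"
  shows "\<exists>n\<ge>m. c n"
proof (rule ccontr)
  assume "\<not> (\<exists>n\<ge>m. c n)"
  then have no: "\<not> c n" if "n \<ge> m" for n using that by blast
  define z where "z = N + m + 2"
  have z: "1 \<le> z" "N \<le> z" "m \<le> z" by (simp_all add: z_def)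
  have "2 * z \<le> z\<^sup>2" by (simp add: z_def power2_eq_square)
  then obtain y where y: "z\<^sup>2 = z + y" "z \<le> y"
    using nat_le_iff_add[of z "z\<^sup>2"] by (metis add_le_cancel_left le_add1 le_trans mult_2)
  then show False
    using avoidingD[OF av, of z y z] no[of z] no[of y] z by simp
qed

lemma next_switch:
  assumes av: "avoiding N c" and "c n"
  obtains m where "n \<le> m" "\<And>i. n \<le> i \<Longrightarrow> i \<le> m \<Longrightarrow> c i" "\<not> c (m + 1)"
proof -
  obtain i where "n \<le> i" "\<not> c i" using avoiding_recurs[OF avoiding_swap[OF av]] by blast
  then have i: "\<not> c (n + (i - n))" by simp
  define d where "d = (LEAST d. \<not> c (n + d))"
  have d: "\<not> c (n + d)" unfolding d_def by (rule LeastI[of "\<lambda>d. \<not> c (n + d)", OF i])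
  have less: "c (n + e)" if "e < d" for e
    using not_less_Least[of e "\<lambda>d. \<not> c (n + d)"] that by (auto simp: d_def)
  have "d \<noteq> 0" using d assms(2) by (intro notI) simp
  show ?thesis
  proof (rule that[of "n + d - 1"])
    show "c i" if "n \<le> i" "i \<le> n + d - 1" for i
      using less[of "i - n"] that \<open>d \<noteq> 0\<close> by auto
  qed (use d \<open>d \<noteq> 0\<close> in auto)
qed

text \<open>Three successive runs end at \<open>z1\<close>, \<open>w\<close> and \<open>z2\<close>. Two of them are bounded by \<open>run_length_bound\<close>,
  which gives \<open>z2 \<le> 4(4 z1 + 2) + 2 = 16 z1 + 10 \<le> 17 z1\<close>.\<close>

lemma not_avoiding:
  assumes "1 \<le> N"
  shows "\<not> avoiding N c"
proof
  assume av: "avoiding N c"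
  note av' = avoiding_swap[OF av]
  obtain n where n: "40 * (N + 2) \<le> n" "c n" using avoiding_recurs[OF av] by blast
  obtain z1 where z1: "n \<le> z1" "\<And>i. n \<le> i \<Longrightarrow> i \<le> z1 \<Longrightarrow> c i" "\<not> c (z1 + 1)"
    using next_switch[OF av n(2)] by metis
  obtain w where w: "z1 + 1 \<le> w" "\<And>i. z1 + 1 \<le> i \<Longrightarrow> i \<le> w \<Longrightarrow> \<not> c i" "c (w + 1)"
    using next_switch[OF av', of "z1 + 1"] z1(3) by auto
  obtain z2 where z2: "w + 1 \<le> z2" "\<And>i. w + 1 \<le> i \<Longrightarrow> i \<le> z2 \<Longrightarrow> c i" "\<not> c (z2 + 1)"
    using next_switch[OF av w(3)] by metis
  have "w \<le> 4 * z1 + 2" using run_length_bound[OF av', of w z1] w z1 n by auto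
  moreover have "z2 \<le> 4 * w + 2" using run_length_bound[OF av, of z2 w] w z1 z2 n by auto
  moreover have "80 \<le> n" using n(1) by simp
  ultimately have "z2 \<le> 17 * z1" using z1(1) by linarith
  then show False
    using no_close_switches[OF av assms, of z1 w z2] z1 w z2 n by auto
qed

lemma infinite_mono_solutions:
  assumes "colouring 2 C f"
  shows "infinite (mono_solutions f)"
proof
  assume fin: "finite (mono_solutions f)"
  obtain A B where C: "C = {A, B}" using assms by (auto simp: colouring_def card_2_iff)
  have AB: "f n = A \<or> f n = B" if "1 \<le> n" for n
    using assms C that by (auto simp: colouring_def)
  \<comment> \<open>The element 0 keeps the maximum defined when there is no monochromatic solution.\<close>
  define N where "N = Suc (Max (insert 0 ((\<lambda>(x, y, z). z) ` mono_solutions f)))"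
  have N: "z < N" if "(x, y, z) \<in> mono_solutions f" for x y z
  proof -
    have "z \<in> insert 0 ((\<lambda>(x, y, z). z) ` mono_solutions f)" using that by force
    then show ?thesis using fin by (simp add: N_def less_Suc_eq_le)
  qed
  have "avoiding N (\<lambda>n. f n = A)"
    unfolding avoiding_def
  proof (intro allI impI notI)
    fix x y z :: nat
    assume xyz: "1 \<le> x" "1 \<le> y" "N \<le> z" "x + y = z\<^sup>2"
      and same: "(f x = A) = (f y = A) \<and> (f y = A) = (f z = A)"
    have "1 \<le> z" using xyz by (simp add: N_def)
    then have "f x = f y" "f y = f z"
      using same AB[OF xyz(1)] AB[OF xyz(2)] AB[of z] by metis+
    then have "(x, y, z) \<in> mono_solutions f"
      using xyz \<open>1 \<le> z\<close> by (simp add: mono_solutions_def)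
    then have "z < N" by (rule N)
    then show False using xyz(3) by simp
  qed
  then show False using not_avoiding[of N] by (simp add: N_def)
qed

theorem theorem1p1:
  shows "(\<exists>(C :: nat set) f. colouring 3 C f \<and> mono_solutions f = {(2, 2, 2)})
    \<and> (\<forall>(C :: 'c set) f. colouring 2 C f \<longrightarrow> infinite (mono_solutions f))"
  using colouring_block_colour mono_solutions_block_colour infinite_mono_solutions by blast

end
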